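(* Let $n\in\mathbb{N}$, let $D\subseteq\mathbb{Z}_2^n$, let $C$ be a finite set, let $f\colon D\to C$, and let $\delta>0$. Suppose a $T$-query quantum algorithm, given by an initial unit vector $|\xi\rangle\in\mathbb{C}^{Q\times W}$ and unitaries $U^0,\dots,U^T$ on $\mathbb{C}^{Q\times W}$, evaluates $f$ with success bias $\delta$: its final states $|\tau_x\rangle=U^TO_xU^{T-1}O_x\cdots U^1O_xU^0|\xi\rangle$ ($x\in D$) and some orthogonal projectors $(P_c)_{c\in C}$ on $\mathbb{C}^{Q\times W}$ with $P_cP_{c'}=0$ for $c\neq c'$ satisfy $\|P_{f(x)}|\tau_x\rangle\|^2\ge\frac12+\delta$ for all $x\in D$. Then there exist collections of normalized states $(|\xi'_x\rangle)_{x\in D}$ and $(|\tau'_x\rangle)_{x\in D}$ in $\mathbb{C}^{Q\times W}$ such that: 1. $|\tau'_x\rangle=U^TO_xU^{T-1}O_x\cdots U^1O_xU^0|\xi'_x\rangle$ for all $x\in D$; 2. $\langle\tau'_x|\tau'_{x'}\rangle=0$ for all $x,x'\in D$ with $f(x)\neq f(x')$; 3. $\langle\xi|\xi'_x\rangle=\|P_{f(x)}|\tau_x\rangle\|\ge\sqrt{1/2+\delta}$ for all $x\in D$.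
   Context: Query model: bit strings $x\in D$ have coordinates $x_0,\dots,x_{n-1}$. $Q:=\{0,1,\dots,n\}$, and $W$ is a finite set of arbitrary size ($\mathbb{C}^W$ is the ancilla space). For $x\in D$ the phase oracle is the unitary $O_x$ on $\mathbb{C}^Q$ with $O_x|j\rangle=(-1)^{x_j}|j\rangle$ for $j<n$ and $O_x|n\rangle=|n\rangle$; it acts on $\mathbb{C}^{Q\times W}=\mathbb{C}^Q\otimes\mathbb{C}^W$ as $O_x\otimes I$. The initial state $|\xi\rangle$ and the unitaries $U^0,\dots,U^T$ do not depend on $x$. "Normalized" means of norm 1. *)

theory Defs
  imports
    "Jordan_Normal_Form.Schur_Decomposition"
    "HOL-Library.Z2"
    "HOL-Library.FuncSet"
begin

text \<open>
  \<open>u \<bullet>c v\<close> conjugates its second argument, whereas the bracket is conjugate-linear in its first.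
\<close>

definition braket :: "complex vec \<Rightarrow> complex vec \<Rightarrow> complex" where
  "braket u v = v \<bullet>c u"

definition ket_norm :: "complex vec \<Rightarrow> real" where
  "ket_norm v = sqrt (Re (braket v v))"

definition normalized_state :: "nat \<Rightarrow> complex vec \<Rightarrow> bool" where
  "normalized_state N v \<longleftrightarrow> v \<in> carrier_vec N \<and> ket_norm v = 1"

definition unitary_mat :: "nat \<Rightarrow> complex mat \<Rightarrow> bool" where
  "unitary_mat N U \<longleftrightarrow>
     U \<in> carrier_mat N N \<and> mat_adjoint U * U = 1\<^sub>m N \<and> U * mat_adjoint U = 1\<^sub>m N"

definition orthogonal_projector :: "nat \<Rightarrow> complex mat \<Rightarrow> bool" where
  "orthogonal_projector N P \<longleftrightarrow>
     P \<in> carrier_mat N N \<and> P * P = P \<and> mat_adjoint P = P"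

text \<open>
  Kronecker product. The basis vector of the product space for a pair \<open>(q, w)\<close> has index
  \<open>q * m + w\<close>, where \<open>m\<close> is the dimension of the second factor.
\<close>

definition kronecker :: "complex mat \<Rightarrow> complex mat \<Rightarrow> complex mat" where
  "kronecker A B = mat (dim_row A * dim_row B) (dim_col A * dim_col B)
     (\<lambda>(i, j). A $$ (i div dim_row B, j div dim_col B) * B $$ (i mod dim_row B, j mod dim_col B))"

text \<open>The phase oracle on the query register, whose basis is indexed by \<open>0, \<dots>, n\<close>.\<close>

definition phase_oracle :: "nat \<Rightarrow> bit vec \<Rightarrow> complex mat" where
  "phase_oracle n x = mat_diag (Suc n) (\<lambda>j. if j < n \<and> x $ j = 1 then - 1 else 1)"

text \<open>
  \<open>query_run Or U T v\<close> is \<open>U T Or U (T - 1) Or \<dots> U 1 Or U 0 v\<close>, with \<open>T\<close> applications of \<open>Or\<close>.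
\<close>

fun query_run ::
  "complex mat \<Rightarrow> (nat \<Rightarrow> complex mat) \<Rightarrow> nat \<Rightarrow> complex vec \<Rightarrow> complex vec" where
  "query_run Or U 0 v = U 0 *\<^sub>v v"
| "query_run Or U (Suc t) v = U (Suc t) *\<^sub>v (Or *\<^sub>v query_run Or U t v)"

text \<open>
  The final state for input \<open>x\<close>. The ancilla space has dimension \<open>m\<close>, and the oracle acts on it
  trivially.
\<close>

definition final_state ::
  "nat \<Rightarrow> nat \<Rightarrow> (nat \<Rightarrow> complex mat) \<Rightarrow> nat \<Rightarrow> bit vec \<Rightarrow> complex vec \<Rightarrow> complex vec" where
  "final_state n m U T x v = query_run (kronecker (phase_oracle n x) (1\<^sub>m m)) U T v"

end

theory Submission
  imports Defs
begin

text \<open>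
  The run with oracle \<open>O\<^sub>x\<close> is a single unitary \<open>V\<^sub>x\<close>. Normalize the projection
  of the final state \<open>V\<^sub>x \<xi>\<close> onto the range of the projector \<open>P\<close> of the value \<open>f x\<close>, and
  pull the result back along \<open>V\<^sub>x\<close>. Ranges of distinct projectors are orthogonal, and the overlap
  with \<open>\<xi>\<close> equals that of \<open>V\<^sub>x \<xi>\<close> with its own normalized projection, which is the norm of
  the projection.
\<close>

section \<open>Adjoints, the bracket and its norm\<close>

lemma mat_adjoint_dim [simp]:
  "dim_row (mat_adjoint A) = dim_col A" "dim_col (mat_adjoint A) = dim_row A"
  by (simp_all add: mat_adjoint_def)

lemma mat_adjoint_carrier: "A \<in> carrier_mat r c \<Longrightarrow> mat_adjoint A \<in> carrier_mat c r"
  by auto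

lemma mat_adjoint_index [simp]:
  "i < dim_col A \<Longrightarrow> j < dim_row A \<Longrightarrow> mat_adjoint A $$ (i, j) = conjugate (A $$ (j, i))"
  by (simp add: mat_adjoint_def mat_of_rows_def)

lemma mat_adjoint_mult:
  fixes A B :: "complex mat"
  assumes A: "A \<in> carrier_mat a b" and B: "B \<in> carrier_mat b c"
  shows "mat_adjoint (A * B) = mat_adjoint B * mat_adjoint A"
proof (rule eq_matI)
  fix i j
  assume "i < dim_row (mat_adjoint B * mat_adjoint A)" "j < dim_col (mat_adjoint B * mat_adjoint A)"
  then show "mat_adjoint (A * B) $$ (i, j) = (mat_adjoint B * mat_adjoint A) $$ (i, j)"
    using A B by (simp add: scalar_prod_def mult.commute)
qed (use A B in auto)

text \<open>Both sides expand to one double sum over the entries of \<open>A\<close>, taken in the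
  two orders of summation.\<close>

lemma braket_mult_mat_left:
  assumes A: "A \<in> carrier_mat r c" and u: "u \<in> carrier_vec c" and v: "v \<in> carrier_vec r"
  shows "braket (A *\<^sub>v u) v = braket u (mat_adjoint A *\<^sub>v v)"
proof -
  have "braket (A *\<^sub>v u) v = (\<Sum>i<r. \<Sum>j<c. v $ i * (cnj (A $$ (i, j)) * cnj (u $ j)))"
    using A u v
    by (simp add: braket_def scalar_prod_def atLeast0LessThan sum_distrib_left)
  also have "\<dots> = (\<Sum>j<c. \<Sum>i<r. v $ i * (cnj (A $$ (i, j)) * cnj (u $ j)))"
    by (rule sum.swap)
  also have "\<dots> = braket u (mat_adjoint A *\<^sub>v v)"
    using A u v
    by (simp add: braket_def scalar_prod_def atLeast0LessThan sum_distrib_left mult_ac)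
  finally show ?thesis .
qed

text \<open>\<open>ket_norm\<close> takes a real part before the root, so this needs
  \<open>braket v v\<close> to be real and nonnegative: it is the sum of the squared moduli of the
  coordinates.\<close>

lemma ket_norm_sq: "braket v v = complex_of_real ((ket_norm v)\<^sup>2)"
proof -
  have "braket v v = complex_of_real (\<Sum>i<dim_vec v. (cmod (v $ i))\<^sup>2)"
    by (simp add: braket_def scalar_prod_def atLeast0LessThan complex_mult_cnj
        cmod_power2)
  moreover have "(\<Sum>i<dim_vec v. (cmod (v $ i))\<^sup>2) \<ge> 0"
    by (simp add: sum_nonneg)
  ultimately show ?thesis
    by (simp add: ket_norm_def)
qed

lemma ket_norm_nonneg: "ket_norm v \<ge> 0"
proof -
  have "Re (braket v v) \<ge> 0"
    by (simp add: ket_norm_sq)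
  then show ?thesis
    by (simp add: ket_norm_def)
qed

lemma braket_smult:
  assumes "u \<in> carrier_vec N" "v \<in> carrier_vec N"
  shows "braket u (a \<cdot>\<^sub>v v) = a * braket u v" "braket (a \<cdot>\<^sub>v u) v = cnj a * braket u v"
  using assms by (simp_all add: braket_def conjugate_smult_vec)

lemma normalized_state_normalize:
  assumes v: "v \<in> carrier_vec N" and pos: "ket_norm v > 0"
  shows "normalized_state N (complex_of_real (1 / ket_norm v) \<cdot>\<^sub>v v)"
    (is "normalized_state N (?c \<cdot>\<^sub>v v)")
proof -
  have "braket (?c \<cdot>\<^sub>v v) (?c \<cdot>\<^sub>v v) = ?c * (?c * braket v v)"
    using v by (simp add: braket_smult[of _ N])
  also have "\<dots> = 1"
    using pos unfolding ket_norm_sq by (simp add: power2_eq_square)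
  finally show ?thesis
    using v by (simp add: normalized_state_def ket_norm_def)
qed

section \<open>Unitary matrices, and the query run as one of them\<close>

lemma mat_adjoint_adjoint: "mat_adjoint (mat_adjoint A) = (A :: complex mat)"
  by (rule eq_matI) auto

lemma unitary_mat_mult:
  assumes V: "unitary_mat N V" and W: "unitary_mat N W"
  shows "unitary_mat N (V * W)"
proof -
  have c: "V \<in> carrier_mat N N" "W \<in> carrier_mat N N"
    "mat_adjoint V \<in> carrier_mat N N" "mat_adjoint W \<in> carrier_mat N N"
    using V W by (auto simp: unitary_mat_def intro: mat_adjoint_carrier)
  have adj: "mat_adjoint (V * W) = mat_adjoint W * mat_adjoint V"
    using c by (intro mat_adjoint_mult)
  have "mat_adjoint W * mat_adjoint V * (V * W) = mat_adjoint W * ((mat_adjoint V * V) * W)"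
    using c by (simp add: assoc_mult_mat[of _ N N _ N _ N])
  moreover have "V * W * (mat_adjoint W * mat_adjoint V) = V * ((W * mat_adjoint W) * mat_adjoint V)"
    using c by (simp add: assoc_mult_mat[of _ N N _ N _ N])
  ultimately show ?thesis
    using V W c unfolding unitary_mat_def adj by simp
qed

text \<open>Moving the adjoint across the bracket produces \<open>V * mat_adjoint V\<close>, which
  unitarity makes the identity.\<close>

lemma normalized_state_mult_adjoint:
  assumes V: "unitary_mat N V" and v: "normalized_state N v"
  shows "normalized_state N (mat_adjoint V *\<^sub>v v)"
proof -
  have c: "V \<in> carrier_mat N N" "mat_adjoint V \<in> carrier_mat N N" "v \<in> carrier_vec N"
    using V v by (auto simp: unitary_mat_def normalized_state_def intro: mat_adjoint_carrier)
  have "braket (mat_adjoint V *\<^sub>v v) (mat_adjoint V *\<^sub>v v) = braket v (V *\<^sub>v (mat_adjoint V *\<^sub>v v))"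
    using c by (simp add: braket_mult_mat_left[of _ N N] mat_adjoint_adjoint)
  also have "V *\<^sub>v (mat_adjoint V *\<^sub>v v) = v"
    using c V by (simp add: assoc_mult_mat_vec[symmetric] unitary_mat_def)
  finally show ?thesis
    using c v by (simp add: normalized_state_def ket_norm_def)
qed

lemma unitary_mat_diag:
  assumes "\<And>i. i < N \<Longrightarrow> cmod (d i) = 1"
  shows "unitary_mat N (mat_diag N d)"
proof -
  have "mat_adjoint (mat_diag N d) = mat_diag N (\<lambda>i. cnj (d i))"
    by (rule eq_matI) (auto simp: mat_diag_def)
  moreover have "d i * cnj (d i) = 1" if "i < N" for i
    using assms[OF that] by (simp add: complex_norm_square[symmetric])
  then have "mat_diag N (\<lambda>i. d i * cnj (d i)) = 1\<^sub>m N"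
    by (intro eq_matI) (auto simp: mat_diag_def)
  ultimately show ?thesis
    by (simp add: unitary_mat_def mult.commute)
qed

text \<open>An index \<open>i\<close> encodes the pair \<open>(i div m, i mod m)\<close>. Both
  factors are diagonal, so an entry survives only when both components agree, and its value depends
  on the query component alone.\<close>

lemma kronecker_mat_diag_one:
  "kronecker (mat_diag k d) (1\<^sub>m m) = mat_diag (k * m) (\<lambda>i. d (i div m))"
proof (rule eq_matI)
  fix i j
  assume ij: "i < dim_row (mat_diag (k * m) (\<lambda>i. d (i div m)))"
    "j < dim_col (mat_diag (k * m) (\<lambda>i. d (i div m)))"
  then have lt: "i < k * m" "j < k * m"
    by (auto simp: mat_diag_def)
  \<comment> \<open>The bound \<open>i < k * m\<close> already excludes \<open>m = 0\<close>, so
    both remainders are valid indices of the identity matrix.\<close>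
  then have "m > 0" "i div m < k" "j div m < k"
    by (auto simp: less_mult_imp_div_less intro: Nat.gr0I)
  moreover have "i = j \<longleftrightarrow> i div m = j div m \<and> i mod m = j mod m"
    by (metis div_mult_mod_eq)
  ultimately show "kronecker (mat_diag k d) (1\<^sub>m m) $$ (i, j)
      = mat_diag (k * m) (\<lambda>i. d (i div m)) $$ (i, j)"
    using lt by (auto simp: kronecker_def mat_diag_def)
qed (auto simp: kronecker_def mat_diag_def)

lemma unitary_oracle: "unitary_mat (Suc n * m) (kronecker (phase_oracle n x) (1\<^sub>m m))"
  unfolding phase_oracle_def kronecker_mat_diag_one by (rule unitary_mat_diag) auto

text \<open>The quantifier order matters: one \<open>V\<close> serves every initial vector, so the
  same unitary governs the run from the given state and the run from the modified one.\<close>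

lemma query_run_unitary:
  assumes Or: "unitary_mat N Or" and U: "\<forall>t\<le>T. unitary_mat N (U t)"
  shows "\<exists>V. unitary_mat N V \<and> (\<forall>v\<in>carrier_vec N. query_run Or U T v = V *\<^sub>v v)"
  using U
proof (induction T)
  case 0
  then show ?case
    by auto
next
  case (Suc T)
  then obtain V where V: "unitary_mat N V" "\<forall>v\<in>carrier_vec N. query_run Or U T v = V *\<^sub>v v"
    by force
  have UT: "unitary_mat N (U (Suc T))"
    using Suc.prems by simp
  have c: "V \<in> carrier_mat N N" "Or \<in> carrier_mat N N" "U (Suc T) \<in> carrier_mat N N"
    using V UT Or by (auto simp: unitary_mat_def)
  have "query_run Or U (Suc T) v = (U (Suc T) * (Or * V)) *\<^sub>v v" if "v \<in> carrier_vec N" for v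
    using that c V(2) by (simp add: assoc_mult_mat_vec[of _ N N _ N])
  then show ?case
    using unitary_mat_mult[OF UT unitary_mat_mult[OF Or V(1)]] by blast
qed

section \<open>Orthogonal projectors\<close>

text \<open>Self-adjointness moves one \<open>P\<close> across the bracket, and idempotence absorbs
  it into the other.\<close>

lemma projector_overlap:
  assumes P: "orthogonal_projector N P" and v: "v \<in> carrier_vec N"
  shows "braket v (P *\<^sub>v v) = complex_of_real ((ket_norm (P *\<^sub>v v))\<^sup>2)"
proof -
  have c: "P \<in> carrier_mat N N" "P * P = P" "mat_adjoint P = P"
    using P by (auto simp: orthogonal_projector_def)
  have "braket (P *\<^sub>v v) (P *\<^sub>v v) = braket v (P *\<^sub>v (P *\<^sub>v v))"
    using braket_mult_mat_left[OF c(1) v, of "P *\<^sub>v v"] c v by simp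
  also have "\<dots> = braket v (P *\<^sub>v v)"
    using c v by (metis assoc_mult_mat_vec)
  finally show ?thesis
    by (simp add: ket_norm_sq)
qed

text \<open>Moving the self-adjoint \<open>P\<close> to the right places it next to
  \<open>Q\<close>, and the product vanishes.\<close>

lemma projector_ranges_orthogonal:
  assumes P: "orthogonal_projector N P" and Q: "orthogonal_projector N Q" and PQ: "P * Q = 0\<^sub>m N N"
    and u: "u \<in> carrier_vec N" and v: "v \<in> carrier_vec N"
  shows "braket (P *\<^sub>v u) (Q *\<^sub>v v) = 0"
proof -
  have c: "P \<in> carrier_mat N N" "Q \<in> carrier_mat N N" "mat_adjoint P = P"
    using P Q by (auto simp: orthogonal_projector_def)
  have "braket (P *\<^sub>v u) (Q *\<^sub>v v) = braket u (P *\<^sub>v (Q *\<^sub>v v))"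
    using braket_mult_mat_left[OF c(1) u, of "Q *\<^sub>v v"] c v by simp
  also have "P *\<^sub>v (Q *\<^sub>v v) = 0\<^sub>v N"
    unfolding assoc_mult_mat_vec[OF c(1,2) v, symmetric] PQ using v by (intro eq_vecI) auto
  finally show ?thesis
    using u by (simp add: braket_def)
qed

section \<open>Modified initial states whose final states are perfectly distinguishable\<close>

theorem lemma1:
  fixes n m T :: nat
    and D :: "bit vec set"
    and C :: "'c set"
    and f :: "bit vec \<Rightarrow> 'c"
    and \<delta> :: real
    and \<xi> :: "complex vec"
    and U :: "nat \<Rightarrow> complex mat"
    and P :: "'c \<Rightarrow> complex mat"
  assumes "D \<subseteq> carrier_vec n"
    and "finite C"
    and "f \<in> D \<rightarrow> C"
    and "\<delta> > 0"
    and "normalized_state (Suc n * m) \<xi>"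
    and "\<forall>t\<le>T. unitary_mat (Suc n * m) (U t)"
    and "\<forall>c\<in>C. orthogonal_projector (Suc n * m) (P c)"
    and "\<forall>c\<in>C. \<forall>c'\<in>C. c \<noteq> c' \<longrightarrow> P c * P c' = 0\<^sub>m (Suc n * m) (Suc n * m)"
    and "\<forall>x\<in>D. (ket_norm (P (f x) *\<^sub>v final_state n m U T x \<xi>))\<^sup>2 \<ge> 1 / 2 + \<delta>"
  shows "\<exists>\<xi>' \<tau>' :: bit vec \<Rightarrow> complex vec.
      (\<forall>x\<in>D. normalized_state (Suc n * m) (\<xi>' x) \<and> normalized_state (Suc n * m) (\<tau>' x)) \<and>
      (\<forall>x\<in>D. \<tau>' x = final_state n m U T x (\<xi>' x)) \<and>
      (\<forall>x\<in>D. \<forall>x'\<in>D. f x \<noteq> f x' \<longrightarrow> braket (\<tau>' x) (\<tau>' x') = 0) \<and>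
      (\<forall>x\<in>D. braket \<xi> (\<xi>' x)
               = complex_of_real (ket_norm (P (f x) *\<^sub>v final_state n m U T x \<xi>)) \<and>
             ket_norm (P (f x) *\<^sub>v final_state n m U T x \<xi>) \<ge> sqrt (1 / 2 + \<delta>))"
proof -
  define N where "N = Suc n * m"
  \<comment> \<open>The component of the final state on which the measurement gives the correct
    answer, not yet normalized.\<close>
  define p where "p x = P (f x) *\<^sub>v final_state n m U T x \<xi>" for x
  note asm = assms[folded N_def]
  have "\<exists>V. unitary_mat N V \<and> (\<forall>v\<in>carrier_vec N. final_state n m U T x v = V *\<^sub>v v)" for x
    unfolding final_state_def
    by (rule query_run_unitary[OF unitary_oracle[of n m x, folded N_def] asm(6)])
  then obtain V where V: "unitary_mat N (V x)"
    and run: "v \<in> carrier_vec N \<Longrightarrow> final_state n m U T x v = V x *\<^sub>v v" for x v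
    by metis
  have xi: "\<xi> \<in> carrier_vec N"
    using asm(5) by (simp add: normalized_state_def)
  have Vc: "V x \<in> carrier_mat N N" "mat_adjoint (V x) \<in> carrier_mat N N" for x
    using V[of x] by (auto simp: unitary_mat_def intro: mat_adjoint_carrier)
  have final: "final_state n m U T x \<xi> \<in> carrier_vec N" for x
    using mult_mat_vec_carrier[OF Vc(1) xi] by (simp add: run[OF xi])
  have fC: "f x \<in> C" and Pf: "orthogonal_projector N (P (f x))" if "x \<in> D" for x
    using asm(3,7) that by auto
  have pc: "p x \<in> carrier_vec N" if "x \<in> D" for x
    using Pf[OF that] final unfolding p_def orthogonal_projector_def
    by (metis mult_mat_vec_carrier)
  have bias: "ket_norm (p x) \<ge> sqrt (1 / 2 + \<delta>)" if "x \<in> D" for x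
    using real_sqrt_le_mono[OF asm(9)[rule_format, OF that]] ket_norm_nonneg[of "p x"]
    by (simp add: p_def)
  \<comment> \<open>Strict positivity allows dividing by this norm; for a zero projection the factor
    \<open>1 / ket_norm (p x)\<close> would be 0 and could not normalize.\<close>
  have pos: "ket_norm (p x) > 0" if "x \<in> D" for x
  proof -
    have "sqrt (1 / 2 + \<delta>) > 0"
      using asm(4) by simp
    then show ?thesis
      using bias[OF that] by linarith
  qed
  define \<tau>' where "\<tau>' x = complex_of_real (1 / ket_norm (p x)) \<cdot>\<^sub>v p x" for x
  \<comment> \<open>The adjoint inverts \<open>V x\<close>, so this is the initial state that the
    run on input \<open>x\<close> carries to \<open>\<tau>' x\<close>.\<close>
  define \<xi>' where "\<xi>' x = mat_adjoint (V x) *\<^sub>v \<tau>' x" for x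
  have tau: "normalized_state N (\<tau>' x)" if "x \<in> D" for x
    unfolding \<tau>'_def using pc[OF that] pos[OF that] by (rule normalized_state_normalize)
  have tauc: "\<tau>' x \<in> carrier_vec N" if "x \<in> D" for x
    using tau[OF that] by (simp add: normalized_state_def)
  have xi': "normalized_state N (\<xi>' x)" if "x \<in> D" for x
    unfolding \<xi>'_def by (rule normalized_state_mult_adjoint[OF V tau[OF that]])
  have tau_run: "\<tau>' x = final_state n m U T x (\<xi>' x)" if "x \<in> D" for x
  proof -
    have "final_state n m U T x (\<xi>' x) = V x *\<^sub>v (mat_adjoint (V x) *\<^sub>v \<tau>' x)"
      using xi'[OF that] by (simp add: run normalized_state_def \<xi>'_def)
    also have "\<dots> = \<tau>' x"
      using V[of x] tauc[OF that] Vc[of x]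
      by (simp add: assoc_mult_mat_vec[symmetric] unitary_mat_def)
    finally show ?thesis ..
  qed
  have orth: "braket (\<tau>' x) (\<tau>' x') = 0" if "x \<in> D" "x' \<in> D" "f x \<noteq> f x'" for x x'
  proof -
    \<comment> \<open>Normalizing only multiplies the bracket by scalars, so orthogonality may be
      checked on the projections themselves.\<close>
    have "braket (p x) (p x') = 0"
      unfolding p_def
      using that asm(8) fC final by (intro projector_ranges_orthogonal[OF Pf Pf]) auto
    then show ?thesis
      using pc that by (simp add: \<tau>'_def braket_smult[of _ N])
  qed
  have overlap: "braket \<xi> (\<xi>' x) = complex_of_real (ket_norm (p x))" if "x \<in> D" for x
  proof -
    \<comment> \<open>Pulling back by the adjoint on the right equals running forward on the left.
      The overlap then becomes the squared norm of \<open>p x\<close> divided by that norm.\<close>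
    have "braket \<xi> (\<xi>' x) = braket (final_state n m U T x \<xi>) (\<tau>' x)"
      unfolding \<xi>'_def run[OF xi] using braket_mult_mat_left[OF Vc(1) xi tauc[OF that]] by simp
    also have "\<dots> = complex_of_real (1 / ket_norm (p x)) * braket (final_state n m U T x \<xi>) (p x)"
      unfolding \<tau>'_def by (rule braket_smult(1)[OF final pc[OF that]])
    also have "braket (final_state n m U T x \<xi>) (p x) = complex_of_real ((ket_norm (p x))\<^sup>2)"
      unfolding p_def by (rule projector_overlap[OF Pf[OF that] final])
    finally show ?thesis
      using pos[OF that] by (simp add: power2_eq_square)
  qed
  show ?thesis
    unfolding N_def[symmetric] p_def[symmetric]
    by (intro exI[of _ \<xi>'] exI[of _ \<tau>'] conjI ballI impI)
      (rule xi' tau tau_run orth overlap bias; assumption)+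
qed

end
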